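(* Let $R$ be an $\mathscr{H}$-semicommutative ring. If $R$ is a left SF-ring, then $R$ is strongly regular.
   Context: Rings are associative with unity (unless the ring is a nil ring). For a ring $R$, the hypercenter is $T(R)=\{a\in R : \text{for every } x\in R \text{ there is } n=n(x,a)\geq 1 \text{ with } ax^{n}=x^{n}a\}$. A ring $R$ is called $\mathscr{H}$-semicommutative if for all $u,v\in R$, $uv=0$ implies $uRv\subseteq T(R)$. $R$ is a left SF-ring if every simple left $R$-module is flat. $R$ is strongly regular if for every $a\in R$ there is $b\in R$ with $a=a^{2}b$. *)

theory Defs
  imports "HOL-Algebra.Algebra"
begin

section \<open>Hypercenter, H-semicommutative and strongly regular rings\<close>

definition hypercenter :: "('a, 'm) ring_scheme \<Rightarrow> 'a set" where
  "hypercenter R = {a \<in> carrier R. \<forall>x \<in> carrier R. \<exists>n::nat. n \<ge> 1 \<and>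
      a \<otimes>\<^bsub>R\<^esub> (x [^]\<^bsub>R\<^esub> n) = (x [^]\<^bsub>R\<^esub> n) \<otimes>\<^bsub>R\<^esub> a}"

definition H_semicommutative :: "('a, 'm) ring_scheme \<Rightarrow> bool" where
  "H_semicommutative R \<longleftrightarrow> (\<forall>u \<in> carrier R. \<forall>v \<in> carrier R. u \<otimes>\<^bsub>R\<^esub> v = \<zero>\<^bsub>R\<^esub> \<longrightarrow>
      {u \<otimes>\<^bsub>R\<^esub> r \<otimes>\<^bsub>R\<^esub> v | r. r \<in> carrier R} \<subseteq> hypercenter R)"

definition strongly_regular :: "('a, 'm) ring_scheme \<Rightarrow> bool" where
  "strongly_regular R \<longleftrightarrow>
     (\<forall>a \<in> carrier R. \<exists>b \<in> carrier R. a = (a [^]\<^bsub>R\<^esub> (2::nat)) \<otimes>\<^bsub>R\<^esub> b)"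


section \<open>Modules over a not necessarily commutative ring\<close>

text \<open>The library locale \<^locale>\<open>module\<close> requires a commutative ring. The same record type is
  used here, over an arbitrary unital ring; in a right module, \<open>r \<odot> x\<close> stands for the
  right action \<open>x \<cdot> r\<close>.\<close>

locale left_module = R?: ring R + M?: abelian_group M
  for R :: "('a, 'm) ring_scheme" (structure) and M :: "('a, 'b) module" (structure) +
  assumes smult_closed:
      "\<lbrakk>r \<in> carrier R; x \<in> carrier M\<rbrakk> \<Longrightarrow> r \<odot>\<^bsub>M\<^esub> x \<in> carrier M"
    and smult_l_distr:
      "\<lbrakk>r \<in> carrier R; s \<in> carrier R; x \<in> carrier M\<rbrakk> \<Longrightarrow>
       (r \<oplus>\<^bsub>R\<^esub> s) \<odot>\<^bsub>M\<^esub> x = (r \<odot>\<^bsub>M\<^esub> x) \<oplus>\<^bsub>M\<^esub> (s \<odot>\<^bsub>M\<^esub> x)"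
    and smult_r_distr:
      "\<lbrakk>r \<in> carrier R; x \<in> carrier M; y \<in> carrier M\<rbrakk> \<Longrightarrow>
       r \<odot>\<^bsub>M\<^esub> (x \<oplus>\<^bsub>M\<^esub> y) = (r \<odot>\<^bsub>M\<^esub> x) \<oplus>\<^bsub>M\<^esub> (r \<odot>\<^bsub>M\<^esub> y)"
    and smult_assoc:
      "\<lbrakk>r \<in> carrier R; s \<in> carrier R; x \<in> carrier M\<rbrakk> \<Longrightarrow>
       (r \<otimes>\<^bsub>R\<^esub> s) \<odot>\<^bsub>M\<^esub> x = r \<odot>\<^bsub>M\<^esub> (s \<odot>\<^bsub>M\<^esub> x)"
    and smult_one: "x \<in> carrier M \<Longrightarrow> \<one>\<^bsub>R\<^esub> \<odot>\<^bsub>M\<^esub> x = x"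

locale right_module = R?: ring R + M?: abelian_group M
  for R :: "('a, 'm) ring_scheme" (structure) and M :: "('a, 'b) module" (structure) +
  assumes smult_closed:
      "\<lbrakk>r \<in> carrier R; x \<in> carrier M\<rbrakk> \<Longrightarrow> r \<odot>\<^bsub>M\<^esub> x \<in> carrier M"
    and smult_l_distr:
      "\<lbrakk>r \<in> carrier R; s \<in> carrier R; x \<in> carrier M\<rbrakk> \<Longrightarrow>
       (r \<oplus>\<^bsub>R\<^esub> s) \<odot>\<^bsub>M\<^esub> x = (r \<odot>\<^bsub>M\<^esub> x) \<oplus>\<^bsub>M\<^esub> (s \<odot>\<^bsub>M\<^esub> x)"
    and smult_r_distr:
      "\<lbrakk>r \<in> carrier R; x \<in> carrier M; y \<in> carrier M\<rbrakk> \<Longrightarrow>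
       r \<odot>\<^bsub>M\<^esub> (x \<oplus>\<^bsub>M\<^esub> y) = (r \<odot>\<^bsub>M\<^esub> x) \<oplus>\<^bsub>M\<^esub> (r \<odot>\<^bsub>M\<^esub> y)"
    and smult_assoc:
      "\<lbrakk>r \<in> carrier R; s \<in> carrier R; x \<in> carrier M\<rbrakk> \<Longrightarrow>
       (r \<otimes>\<^bsub>R\<^esub> s) \<odot>\<^bsub>M\<^esub> x = s \<odot>\<^bsub>M\<^esub> (r \<odot>\<^bsub>M\<^esub> x)"
    and smult_one: "x \<in> carrier M \<Longrightarrow> \<one>\<^bsub>R\<^esub> \<odot>\<^bsub>M\<^esub> x = x"

definition simple_left_module :: "('a, 'm) ring_scheme \<Rightarrow> ('a, 'b) module \<Rightarrow> bool" where
  "simple_left_module R M \<longleftrightarrow> left_module R M \<and> carrier M \<noteq> {\<zero>\<^bsub>M\<^esub>} \<and>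
     (\<forall>N. submodule N R M \<longrightarrow> N = {\<zero>\<^bsub>M\<^esub>} \<or> N = carrier M)"

text \<open>Serves left and right modules alike: the order in which ring elements act plays no role in
  the linearity condition.\<close>

definition module_hom ::
  "('a, 'm) ring_scheme \<Rightarrow> ('a, 'b) module \<Rightarrow> ('a, 'c) module \<Rightarrow> ('b \<Rightarrow> 'c) set" where
  "module_hom R A B = {f. f \<in> hom (add_monoid A) (add_monoid B) \<and>
     (\<forall>r \<in> carrier R. \<forall>x \<in> carrier A. f (r \<odot>\<^bsub>A\<^esub> x) = r \<odot>\<^bsub>B\<^esub> f x)}"


section \<open>Tensor products and flatness\<close>

text \<open>For a right module \<open>A\<close> and a left module \<open>M\<close>, the abelian group \<open>A \<otimes>\<^sub>R M\<close> is the free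
  abelian group on \<open>A \<times> M\<close> modulo the subgroup generated by the biadditivity and
  balancedness relations. Recall that \<open>r \<odot>\<^bsub>A\<^esub> a\<close> is \<open>a \<cdot> r\<close>.\<close>

definition tensor_rel ::
  "('a, 'm) ring_scheme \<Rightarrow> ('a, 'b) module \<Rightarrow> ('a, 'c) module \<Rightarrow> ('b \<times> 'c \<Rightarrow>\<^sub>0 int) set" where
  "tensor_rel R A M = generate (free_Abelian_group (carrier A \<times> carrier M))
     ({frag_of (a \<oplus>\<^bsub>A\<^esub> a', x) - frag_of (a, x) - frag_of (a', x) | a a' x.
         a \<in> carrier A \<and> a' \<in> carrier A \<and> x \<in> carrier M} \<union>
      {frag_of (a, x \<oplus>\<^bsub>M\<^esub> x') - frag_of (a, x) - frag_of (a, x') | a x x'.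
         a \<in> carrier A \<and> x \<in> carrier M \<and> x' \<in> carrier M} \<union>
      {frag_of (r \<odot>\<^bsub>A\<^esub> a, x) - frag_of (a, r \<odot>\<^bsub>M\<^esub> x) | a r x.
         a \<in> carrier A \<and> r \<in> carrier R \<and> x \<in> carrier M})"

definition tensor_product ::
  "('a, 'm) ring_scheme \<Rightarrow> ('a, 'b) module \<Rightarrow> ('a, 'c) module \<Rightarrow> ('b \<times> 'c \<Rightarrow>\<^sub>0 int) set monoid" where
  "tensor_product R A M =
     free_Abelian_group (carrier A \<times> carrier M) Mod tensor_rel R A M"

text \<open>The map \<open>f \<otimes> id\<close> from \<open>A \<otimes>\<^sub>R M\<close> to \<open>B \<otimes>\<^sub>R M\<close> induced by \<open>f : A \<rightarrow> B\<close>: a coset is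
  sent to the coset of the image of any of its representatives (the union below is over equal sets,
  see \<open>tensor_map_coset\<close>).\<close>

definition tensor_push :: "('b \<Rightarrow> 'd) \<Rightarrow> ('b \<times> 'c \<Rightarrow>\<^sub>0 int) \<Rightarrow> ('d \<times> 'c \<Rightarrow>\<^sub>0 int)" where
  "tensor_push f = frag_extend (\<lambda>(a, x). frag_of (f a, x))"

definition tensor_map ::
  "('a, 'm) ring_scheme \<Rightarrow> ('a, 'd) module \<Rightarrow> ('a, 'c) module \<Rightarrow> ('b \<Rightarrow> 'd) \<Rightarrow>
   ('b \<times> 'c \<Rightarrow>\<^sub>0 int) set \<Rightarrow> ('d \<times> 'c \<Rightarrow>\<^sub>0 int) set" where
  "tensor_map R B M f K =
     (\<Union>p \<in> K. tensor_rel R B M #>\<^bsub>free_Abelian_group (carrier B \<times> carrier M)\<^esub> tensor_push f p)"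

text \<open>A left module is flat if tensoring preserves injectivity of homomorphisms of right modules.
  HOL cannot quantify over types inside a definition, so the type of the test modules is an explicit
  parameter.\<close>

definition flat_left_module ::
  "'t itself \<Rightarrow> ('a, 'm) ring_scheme \<Rightarrow> ('a, 'b) module \<Rightarrow> bool" where
  "flat_left_module (_ :: 't itself) R M \<longleftrightarrow> left_module R M \<and>
     (\<forall>(A :: ('a, 't) module) (B :: ('a, 't) module) f.
        right_module R A \<longrightarrow> right_module R B \<longrightarrow>
        f \<in> module_hom R A B \<longrightarrow> inj_on f (carrier A) \<longrightarrow>
        inj_on (tensor_map R B M f) (carrier (tensor_product R A M)))"

text \<open>Taking \<^typ>\<open>'a set\<close> for both the simple modules and the test modules is no restriction:
  every simple left module is isomorphic to a quotient \<open>R/L\<close>, whose elements are subsets of \<open>R\<close>;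
  and it is enough to test flatness on inclusions of right ideals into \<open>R\<close>, which have copies in
  \<^typ>\<open>'a set\<close> (on singletons).\<close>

definition left_SF_ring :: "('a, 'm) ring_scheme \<Rightarrow> bool" where
  "left_SF_ring (R :: ('a, 'm) ring_scheme) \<longleftrightarrow> ring R \<and>
     (\<forall>M :: ('a, 'a set) module.
        simple_left_module R M \<longrightarrow> flat_left_module TYPE('a set) R M)"


section \<open>The induced map is well defined\<close>

lemma tensor_push_hom:
  assumes "f \<in> module_hom R A B"
  shows "tensor_push f \<in> hom (free_Abelian_group (carrier A \<times> carrier M))
           (free_Abelian_group (carrier B \<times> carrier M))"
proof (rule homI)
  have fc: "f a \<in> carrier B" if "a \<in> carrier A" for a
    using assms that by (auto simp: module_hom_def hom_def)
  fix p assume p: "p \<in> carrier (free_Abelian_group (carrier A \<times> carrier M))"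
  show "tensor_push f p \<in> carrier (free_Abelian_group (carrier B \<times> carrier M))"
    unfolding tensor_push_def carrier_free_Abelian_group_iff
    using p keys_frag_extend[of "\<lambda>(a, x). frag_of (f a, x)" p] by (fastforce dest: fc)
next
  fix p q
  show "tensor_push f (p \<otimes>\<^bsub>free_Abelian_group (carrier A \<times> carrier M)\<^esub> q) =
    tensor_push f p \<otimes>\<^bsub>free_Abelian_group (carrier B \<times> carrier M)\<^esub> tensor_push f q"
    by (simp add: tensor_push_def frag_extend_add)
qed

lemma tensor_rel_subgroup:
  fixes A :: "('a, 'b) module" and M :: "('a, 'c) module"
  assumes "right_module R A" "left_module R M"
  shows "subgroup (tensor_rel R A M) (free_Abelian_group (carrier A \<times> carrier M))"
proof -
  interpret A: right_module R A by fact
  interpret M: left_module R M by fact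
  have sub: "a - b \<in> carrier (free_Abelian_group S)"
    if "a \<in> carrier (free_Abelian_group S)" "b \<in> carrier (free_Abelian_group S)"
    for a b :: "'b \<times> 'c \<Rightarrow>\<^sub>0 int" and S
    using keys_diff[of a b] that by auto
  show ?thesis
    unfolding tensor_rel_def
    by (rule group.generate_is_subgroup[OF group_free_Abelian_group])
      (auto simp del: carrier_free_Abelian_group_iff
        simp: A.smult_closed M.smult_closed intro!: sub)
qed

lemma tensor_push_rel:
  assumes A: "right_module R A" and B: "right_module R B" and M: "left_module R M"
    and f: "f \<in> module_hom R A B" and p: "p \<in> tensor_rel R A M"
  shows "tensor_push f p \<in> tensor_rel R B M"
proof -
  interpret A: right_module R A by fact
  interpret M: left_module R M by fact
  have fc: "\<And>a. a \<in> carrier A \<Longrightarrow> f a \<in> carrier B"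
    and fadd: "\<And>a b. a \<in> carrier A \<Longrightarrow> b \<in> carrier A \<Longrightarrow> f (a \<oplus>\<^bsub>A\<^esub> b) = f a \<oplus>\<^bsub>B\<^esub> f b"
    and fs: "\<And>a r. a \<in> carrier A \<Longrightarrow> r \<in> carrier R \<Longrightarrow> f (r \<odot>\<^bsub>A\<^esub> a) = r \<odot>\<^bsub>B\<^esub> f a"
    using f by (auto simp: module_hom_def hom_def)
  interpret SB: subgroup "tensor_rel R B M" "free_Abelian_group (carrier B \<times> carrier M)"
    by (rule tensor_rel_subgroup[OF B M])
  have gen: "tensor_push f h \<in> tensor_rel R B M" if "h \<in>
     ({frag_of (a \<oplus>\<^bsub>A\<^esub> a', x) - frag_of (a, x) - frag_of (a', x) | a a' x.
         a \<in> carrier A \<and> a' \<in> carrier A \<and> x \<in> carrier M} \<union>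
      {frag_of (a, x \<oplus>\<^bsub>M\<^esub> x') - frag_of (a, x) - frag_of (a, x') | a x x'.
         a \<in> carrier A \<and> x \<in> carrier M \<and> x' \<in> carrier M} \<union>
      {frag_of (r \<odot>\<^bsub>A\<^esub> a, x) - frag_of (a, r \<odot>\<^bsub>M\<^esub> x) | a r x.
         a \<in> carrier A \<and> r \<in> carrier R \<and> x \<in> carrier M})" for h
    unfolding tensor_rel_def
    by (rule generate.incl) (use that in \<open>auto simp: tensor_push_def frag_extend_diff fadd fs; blast intro: fc\<close>)
  interpret hm: group_hom "free_Abelian_group (carrier A \<times> carrier M)"
      "free_Abelian_group (carrier B \<times> carrier M)" "tensor_push f"
    by (simp add: group_hom_def group_hom_axioms_def tensor_push_hom[OF f])
  interpret SA: subgroup "tensor_rel R A M" "free_Abelian_group (carrier A \<times> carrier M)"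
    by (rule tensor_rel_subgroup[OF A M])
  from p show ?thesis
    unfolding tensor_rel_def[of R A M]
  proof (induction rule: generate.induct)
    case one
    show ?case using SB.one_closed hm.hom_one by simp
  next
    case (incl h)
    then show ?case by (rule gen)
  next
    case (inv h)
    then have "h \<in> tensor_rel R A M"
      unfolding tensor_rel_def by (rule generate.incl)
    then have "tensor_push f (inv\<^bsub>free_Abelian_group (carrier A \<times> carrier M)\<^esub> h) =
      inv\<^bsub>free_Abelian_group (carrier B \<times> carrier M)\<^esub> tensor_push f h"
      by (intro hm.hom_inv SA.mem_carrier)
    then show ?case using SB.m_inv_closed[OF gen[OF inv]] by (metis (no_types, lifting))
  next
    case (eng h1 h2)
    then show ?case
      using SB.m_closed by (simp add: tensor_push_def frag_extend_add)
  qed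
qed

lemma tensor_map_coset:
  assumes A: "right_module R A" and B: "right_module R B" and M: "left_module R M"
    and f: "f \<in> module_hom R A B"
    and p: "p \<in> carrier (free_Abelian_group (carrier A \<times> carrier M))"
  shows "tensor_map R B M f (r_coset (free_Abelian_group (carrier A \<times> carrier M)) (tensor_rel R A M) p) =
    r_coset (free_Abelian_group (carrier B \<times> carrier M)) (tensor_rel R B M) (tensor_push f p)"
proof -
  let ?FB = "free_Abelian_group (carrier B \<times> carrier M)"
  let ?S = "tensor_rel R B M"
  have SB: "subgroup ?S ?FB" by (rule tensor_rel_subgroup[OF B M])
  have SA: "subgroup (tensor_rel R A M) (free_Abelian_group (carrier A \<times> carrier M))"
    by (rule tensor_rel_subgroup[OF A M])
  have pc: "tensor_push f p \<in> carrier ?FB"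
    using tensor_push_hom[OF f] p by (rule hom_in_carrier)
  have "r_coset ?FB ?S (tensor_push f (h + p)) = r_coset ?FB ?S (tensor_push f p)"
    if "h \<in> tensor_rel R A M" for h
  proof -
    have k: "tensor_push f h \<in> ?S" by (rule tensor_push_rel[OF A B M f that])
    have "tensor_push f h \<otimes>\<^bsub>?FB\<^esub> tensor_push f p \<in> r_coset ?FB ?S (tensor_push f p)"
      using k by (auto simp: r_coset_def)
    then have "r_coset ?FB ?S (tensor_push f p) =
        r_coset ?FB ?S (tensor_push f h \<otimes>\<^bsub>?FB\<^esub> tensor_push f p)"
      by (rule group.repr_independence[OF group_free_Abelian_group _ pc SB])
    then show ?thesis by (simp add: tensor_push_def frag_extend_add)
  qed
  moreover have "tensor_rel R A M \<noteq> {}"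
    using subgroup.one_closed[OF SA] by blast
  ultimately show ?thesis
    unfolding tensor_map_def by (auto simp: r_coset_def[of "free_Abelian_group (carrier A \<times> carrier M)"])
qed

end

theory Submission
  imports Defs
begin

text \<open>
  If \<open>L\<close> is a maximal left ideal containing \<open>a\<close>, then flatness of the simple module \<open>R/L\<close>, tested
  against \<open>aR \<subseteq> R\<close>, gives \<open>a \<in> aL\<close>: the tensor \<open>a \<otimes> [1]\<close> vanishes in \<open>R \<otimes> R/L\<close>, hence in
  \<open>aR \<otimes> R/L\<close>, which maps to \<open>aR/aL\<close>. So \<open>a = ab\<close> for some \<open>b \<in> L\<close>, that is, \<open>1 - b \<notin> L\<close> annihilates
  \<open>a\<close> from the right.

  Let \<open>T\<close> be the hypercenter. For \<open>t \<in> T\<close> the left ideal \<open>Rt + {y. yt = 0}\<close> is all of \<open>R\<close>: otherwise it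
  lies in a maximal \<open>L\<close>, and \<open>t = tb\<close> gives \<open>t = tb\<^sup>n = b\<^sup>nt\<close> for a suitable \<open>n\<close>, so \<open>1 - b\<^sup>n\<close> is in
  \<open>L\<close>. Hence \<open>t = st\<^sup>2\<close>, so \<open>t = s\<^sup>nt\<^sup>n\<^sup>+\<^sup>1 = ts\<^sup>nt\<^sup>n\<close> is regular. For arbitrary \<open>a\<close> the left ideal
  \<open>Ra + {y. aRy \<subseteq> T}\<close> contains the right annihilator of \<open>a\<close> by H-semicommutativity, so it too is all of
  \<open>R\<close>. Hence \<open>a - asa \<in> T\<close> for some \<open>s\<close>; this element is regular, and therefore so is \<open>a\<close>.
  Finally, idempotents are central because \<open>ex(1 - e) \<in> T\<close> commutes with \<open>e\<close>.
\<close>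

section \<open>Maximal left ideals\<close>

text \<open>Negatives come from multiplying by \<open>\<ominus> \<one>\<close>, so closure under
  sums and left multiples already yields an additive subgroup.\<close>

definition left_ideal :: "'a set \<Rightarrow> ('a, 'm) ring_scheme \<Rightarrow> bool" where
  "left_ideal L R \<longleftrightarrow> L \<subseteq> carrier R \<and> \<zero>\<^bsub>R\<^esub> \<in> L \<and> (\<forall>x \<in> L. \<forall>y \<in> L. x \<oplus>\<^bsub>R\<^esub> y \<in> L) \<and>
     (\<forall>r \<in> carrier R. \<forall>x \<in> L. r \<otimes>\<^bsub>R\<^esub> x \<in> L)"

text \<open>Properness is expressed as \<open>\<one> \<notin> L\<close>, a condition that passes
  directly to unions of chains.\<close>

definition maximal_left_ideal :: "'a set \<Rightarrow> ('a, 'm) ring_scheme \<Rightarrow> bool" where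
  "maximal_left_ideal L R \<longleftrightarrow> left_ideal L R \<and> \<one>\<^bsub>R\<^esub> \<notin> L \<and>
     (\<forall>K. left_ideal K R \<longrightarrow> L \<subseteq> K \<longrightarrow> \<one>\<^bsub>R\<^esub> \<notin> K \<longrightarrow> K = L)"

context ring
begin

lemma left_idealD:
  assumes "left_ideal L R"
  shows "L \<subseteq> carrier R" "\<zero> \<in> L" "\<And>x y. x \<in> L \<Longrightarrow> y \<in> L \<Longrightarrow> x \<oplus> y \<in> L"
    "\<And>r x. r \<in> carrier R \<Longrightarrow> x \<in> L \<Longrightarrow> r \<otimes> x \<in> L"
  using assms by (auto simp: left_ideal_def)

lemma left_ideal_uminus:
  assumes "left_ideal L R" "x \<in> L"
  shows "\<ominus> x \<in> L"
proof -
  have x: "x \<in> carrier R"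
    using assms left_idealD(1) by blast
  have "(\<ominus> \<one>) \<otimes> x \<in> L"
    using assms by (simp add: left_idealD(4))
  then show ?thesis
    using x by (simp add: l_minus)
qed

lemma left_ideal_minus:
  assumes "left_ideal L R" "x \<in> L" "y \<in> L"
  shows "x \<ominus> y \<in> L"
  using assms by (simp add: a_minus_def left_idealD(3) left_ideal_uminus)

lemma left_ideal_nat_pow:
  assumes "left_ideal L R" "x \<in> L" "n \<ge> 1"
  shows "x [^] (n::nat) \<in> L"
proof -
  have x: "x \<in> carrier R"
    using assms left_idealD(1) by blast
  obtain m where "n = Suc m"
    using assms(3) by (cases n) auto
  then show ?thesis
    using x assms by (simp add: left_idealD(4))
qed

lemma left_ideal_one:
  assumes "left_ideal L R" "\<one> \<in> L"
  shows "L = carrier R"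
proof
  show "L \<subseteq> carrier R"
    by (rule left_idealD(1)[OF assms(1)])
  show "carrier R \<subseteq> L"
    using left_idealD(4)[OF assms(1) _ assms(2)] by fastforce
qed

text \<open>Used twice below: with \<open>N\<close> the left annihilator of a hypercentral
  \<open>t\<close>, and with \<open>N\<close> the set of all \<open>y\<close> such that
  \<open>aRy\<close> lies in the hypercenter.\<close>

lemma left_ideal_principal_add:
  assumes N: "left_ideal N R" and a: "a \<in> carrier R"
  shows "left_ideal {s \<otimes> a \<oplus> y | s y. s \<in> carrier R \<and> y \<in> N} R" (is "left_ideal ?K R")
  unfolding left_ideal_def
proof (intro conjI ballI)
  note Nc = left_idealD(1)[OF N, THEN subsetD]
  show "?K \<subseteq> carrier R"
    using a Nc by auto
  have "\<zero> = \<zero> \<otimes> a \<oplus> \<zero>"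
    using a by simp
  then show "\<zero> \<in> ?K"
    using left_idealD(2)[OF N] by blast
  fix u assume "u \<in> ?K"
  then obtain s y where u: "u = s \<otimes> a \<oplus> y" "s \<in> carrier R" "y \<in> N" by blast
  {
    fix v assume "v \<in> ?K"
    then obtain s' y' where v: "v = s' \<otimes> a \<oplus> y'" "s' \<in> carrier R" "y' \<in> N" by blast
    have "u \<oplus> v = (s \<oplus> s') \<otimes> a \<oplus> (y \<oplus> y')"
      using u v a Nc by (simp add: l_distr a_ac)
    then show "u \<oplus> v \<in> ?K"
      using u v left_idealD(3)[OF N] by blast
  }
  fix r assume r: "r \<in> carrier R"
  have "r \<otimes> u = (r \<otimes> s) \<otimes> a \<oplus> r \<otimes> y"
    using u r a Nc by (simp add: r_distr m_assoc)
  then show "r \<otimes> u \<in> ?K"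
    using u r left_idealD(4)[OF N] by blast
qed

text \<open>Zorn's lemma, applied to the left ideals above \<open>K\<close> that avoid
  \<open>\<one>\<close>.\<close>

lemma ex_maximal_left_ideal:
  assumes K: "left_ideal K R" "\<one> \<notin> K"
  obtains L where "maximal_left_ideal L R" "K \<subseteq> L"
proof -
  define S where "S = {L. left_ideal L R \<and> K \<subseteq> L \<and> \<one> \<notin> L}"
  have "\<exists>M\<in>S. \<forall>U\<in>S. M \<subseteq> U \<longrightarrow> U = M"
  proof (rule subset_Zorn_nonempty)
    show "S \<noteq> {}"
      using K by (auto simp: S_def)
    fix C assume ne: "C \<noteq> {}" and C: "subset.chain S C"
    then have CS: "\<And>L. L \<in> C \<Longrightarrow> left_ideal L R \<and> K \<subseteq> L \<and> \<one> \<notin> L"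
      by (auto simp: subset.chain_def S_def)
    \<comment> \<open>Two members of a chain are comparable, so both summands already lie in the
      larger one.\<close>
    have "x \<oplus> y \<in> \<Union>C" if xy: "U \<in> C" "x \<in> U" "V \<in> C" "y \<in> V" for x y U V
    proof -
      have "U \<subseteq> V \<or> V \<subseteq> U"
        using C xy subset.chain_total by blast
      then show ?thesis
        using xy CS left_idealD(3) by (meson UnionI subsetD)
    qed
    moreover have "\<zero> \<in> \<Union>C"
      using ne CS left_idealD(2) by fastforce
    moreover have "\<Union>C \<subseteq> carrier R"
      using CS left_idealD(1) by blast
    moreover have "r \<otimes> x \<in> \<Union>C" if "r \<in> carrier R" "x \<in> \<Union>C" for r x
      using that CS left_idealD(4) by (meson UnionE UnionI)
    ultimately have "left_ideal (\<Union>C) R"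
      unfolding left_ideal_def by (meson UnionE)
    then show "\<Union>C \<in> S"
      using ne CS by (auto simp: S_def)
  qed
  then obtain M where "M \<in> S" "\<And>U. U \<in> S \<Longrightarrow> M \<subseteq> U \<Longrightarrow> U = M"
    by blast
  then have "maximal_left_ideal M R" "K \<subseteq> M"
    by (auto simp: S_def maximal_left_ideal_def)
  then show ?thesis
    by (rule that)
qed

end

section \<open>The quotient by a left ideal\<close>

text \<open>The cosets of \<open>L\<close> form only a module, since \<open>L\<close> is one-sided;
  \<open>mult\<close> and \<open>one\<close> are present because the module record extends the ring
  record. The union in \<open>smult\<close> avoids choosing a representative: all its members are
  the same coset.\<close>

definition quotient_left_module :: "('a, 'm) ring_scheme \<Rightarrow> 'a set \<Rightarrow> ('a, 'a set) module" where
  "quotient_left_module R L =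
    \<lparr>carrier = a_rcosets\<^bsub>R\<^esub> L, monoid.mult = undefined, one = undefined, ring.zero = L, add = set_add R,
     smult = (\<lambda>r U. \<Union>x \<in> U. L +>\<^bsub>R\<^esub> (r \<otimes>\<^bsub>R\<^esub> x))\<rparr>"

locale ring_left_ideal = ring R for R (structure) +
  fixes L
  assumes left_ideal: "left_ideal L R"
begin

abbreviation "Q \<equiv> quotient_left_module R L"

lemmas L_closed = left_idealD(1)[OF left_ideal, THEN subsetD]

sublocale abelian_subgroup L R
proof (rule abelian_subgroupI3[OF additive_subgroup.intro])
  show "subgroup L (add_monoid R)"
    using left_idealD[OF left_ideal] left_ideal_uminus[OF left_ideal]
    by unfold_locales (auto simp: a_inv_def)
qed unfold_locales

lemma quotient_carrier: "carrier Q = (\<lambda>x. L +> x) ` carrier R"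
  by (auto simp: quotient_left_module_def A_RCOSETS_def')

lemma coset_mem_quotient: "x \<in> carrier R \<Longrightarrow> L +> x \<in> carrier Q"
  by (simp add: quotient_carrier)

lemma quotient_zero: "\<zero>\<^bsub>Q\<^esub> = L"
  by (simp add: quotient_left_module_def)

lemma quotient_add:
  "x \<in> carrier R \<Longrightarrow> y \<in> carrier R \<Longrightarrow> (L +> x) \<oplus>\<^bsub>Q\<^esub> (L +> y) = L +> (x \<oplus> y)"
  by (simp add: quotient_left_module_def a_rcos_sum)

lemma coset_eq_iff:
  assumes "x \<in> carrier R" "y \<in> carrier R"
  shows "L +> x = L +> y \<longleftrightarrow> x \<ominus> y \<in> L"
proof -
  have "L +> x = L +> y \<longleftrightarrow> x \<in> L +> y"
    using assms a_repr_independence'[of x y] a_rcos_self[of x] by auto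
  then show ?thesis
    using assms a_rcos_module_minus[OF ring_axioms] by simp
qed

lemma coset_eq_ideal_iff:
  assumes x: "x \<in> carrier R"
  shows "L +> x = L \<longleftrightarrow> x \<in> L"
proof
  assume eq: "L +> x = L"
  show "x \<in> L"
    using a_rcos_self[OF x] unfolding eq .
qed (rule a_rcos_const)

text \<open>If \<open>y \<ominus> x\<close> lies in \<open>L\<close>, so does its left multiple by
  \<open>r\<close>; hence every representative contributes the same coset to the union.\<close>

lemma quotient_smult:
  assumes r: "r \<in> carrier R" and x: "x \<in> carrier R"
  shows "r \<odot>\<^bsub>Q\<^esub> (L +> x) = L +> (r \<otimes> x)"
proof -
  have "L +> (r \<otimes> y) = L +> (r \<otimes> x)" if "y \<in> L +> x" for y
  proof -
    have y: "y \<in> carrier R"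
      using that x a_elemrcos_carrier by blast
    have "y \<ominus> x \<in> L"
      using that x y a_rcos_module_minus[OF ring_axioms] by blast
    then have "r \<otimes> (y \<ominus> x) \<in> L"
      using left_idealD(4)[OF left_ideal r] by blast
    moreover have "r \<otimes> (y \<ominus> x) = r \<otimes> y \<ominus> r \<otimes> x"
      using r x y by (simp add: a_minus_def r_distr r_minus)
    ultimately show ?thesis
      using r x y by (simp add: coset_eq_iff)
  qed
  then have "(\<Union>y \<in> L +> x. L +> (r \<otimes> y)) = (\<Union>y \<in> L +> x. L +> (r \<otimes> x))"
    by (intro SUP_cong refl)
  also have "\<dots> = L +> (r \<otimes> x)"
    using a_rcos_self[OF x] by (subst UN_constant) (simp split: if_split, blast)
  finally show ?thesis
    by (simp add: quotient_left_module_def)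
qed

lemma quotient_left_module: "left_module R Q"
proof (intro left_module.intro left_module_axioms.intro)
  have zero: "L +> \<zero> = L"
    by (simp add: coset_eq_ideal_iff left_idealD(2)[OF left_ideal])
  show "abelian_group Q"
  proof (rule abelian_groupI)
    show "\<zero>\<^bsub>Q\<^esub> \<in> carrier Q"
      using zero by (auto simp: quotient_carrier quotient_zero intro: image_eqI[of _ _ \<zero>])
    fix U assume "U \<in> carrier Q"
    then obtain x where x: "x \<in> carrier R" "U = L +> x"
      by (auto simp: quotient_carrier)
    show "\<zero>\<^bsub>Q\<^esub> \<oplus>\<^bsub>Q\<^esub> U = U"
      using x quotient_add[of \<zero> x] by (simp add: quotient_zero zero)
    have "(L +> (\<ominus> x)) \<oplus>\<^bsub>Q\<^esub> U = \<zero>\<^bsub>Q\<^esub>"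
      using x by (simp add: quotient_add l_neg zero quotient_zero)
    then show "\<exists>V \<in> carrier Q. V \<oplus>\<^bsub>Q\<^esub> U = \<zero>\<^bsub>Q\<^esub>"
      using x by (auto simp: quotient_carrier)
  next
    fix U V assume "U \<in> carrier Q" "V \<in> carrier Q"
    then obtain x y where xy: "x \<in> carrier R" "U = L +> x" "y \<in> carrier R" "V = L +> y"
      by (auto simp: quotient_carrier)
    then show "U \<oplus>\<^bsub>Q\<^esub> V \<in> carrier Q" "U \<oplus>\<^bsub>Q\<^esub> V = V \<oplus>\<^bsub>Q\<^esub> U"
      by (simp_all add: quotient_add coset_mem_quotient a_comm)
    fix W assume "W \<in> carrier Q"
    then obtain z where "z \<in> carrier R" "W = L +> z"
      by (auto simp: quotient_carrier)
    then show "U \<oplus>\<^bsub>Q\<^esub> V \<oplus>\<^bsub>Q\<^esub> W = U \<oplus>\<^bsub>Q\<^esub> (V \<oplus>\<^bsub>Q\<^esub> W)"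
      using xy by (simp add: quotient_add a_assoc)
  qed
next
  fix r U assume r: "r \<in> carrier R" and "U \<in> carrier Q"
  then obtain x where x: "x \<in> carrier R" "U = L +> x"
    by (auto simp: quotient_carrier)
  show "r \<odot>\<^bsub>Q\<^esub> U \<in> carrier Q"
    using r x by (simp add: quotient_smult coset_mem_quotient)
  {
    fix s assume "s \<in> carrier R"
    then show "(r \<oplus> s) \<odot>\<^bsub>Q\<^esub> U = r \<odot>\<^bsub>Q\<^esub> U \<oplus>\<^bsub>Q\<^esub> s \<odot>\<^bsub>Q\<^esub> U"
      "(r \<otimes> s) \<odot>\<^bsub>Q\<^esub> U = r \<odot>\<^bsub>Q\<^esub> (s \<odot>\<^bsub>Q\<^esub> U)"
      using r x by (simp_all add: quotient_smult quotient_add l_distr m_assoc)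
  }
  fix V assume "V \<in> carrier Q"
  then obtain y where "y \<in> carrier R" "V = L +> y"
    by (auto simp: quotient_carrier)
  then show "r \<odot>\<^bsub>Q\<^esub> (U \<oplus>\<^bsub>Q\<^esub> V) = r \<odot>\<^bsub>Q\<^esub> U \<oplus>\<^bsub>Q\<^esub> r \<odot>\<^bsub>Q\<^esub> V"
    using r x by (simp add: quotient_smult quotient_add r_distr)
next
  fix U assume "U \<in> carrier Q"
  then show "\<one> \<odot>\<^bsub>Q\<^esub> U = U"
    by (auto simp: quotient_carrier quotient_smult)
qed (rule ring_axioms)

text \<open>The preimage \<open>K\<close> in \<open>R\<close> of a submodule \<open>N\<close> is a
  left ideal containing \<open>L\<close>. Maximality leaves only \<open>K = carrier R\<close> or
  \<open>K = L\<close>, and \<open>N\<close> is recovered as the image of \<open>K\<close>.\<close>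

lemma quotient_simple:
  assumes "maximal_left_ideal L R"
  shows "simple_left_module R Q"
  unfolding simple_left_module_def
proof (intro conjI allI impI)
  show "left_module R Q"
    by (rule quotient_left_module)
  have one: "\<one> \<notin> L"
    using assms by (simp add: maximal_left_ideal_def)
  then have "L +> \<one> \<noteq> L"
    by (simp add: coset_eq_ideal_iff)
  then show "carrier Q \<noteq> {\<zero>\<^bsub>Q\<^esub>}"
    by (auto simp: quotient_carrier quotient_zero)
  fix N assume "submodule N R Q"
  then interpret N: submodule N R Q .
  have Nc: "N \<subseteq> carrier Q" and N0: "L \<in> N"
    and Na: "\<And>U V. U \<in> N \<Longrightarrow> V \<in> N \<Longrightarrow> U \<oplus>\<^bsub>Q\<^esub> V \<in> N"
    using N.subset N.one_closed N.m_closed by (auto simp: quotient_zero)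
  define K where "K = {x \<in> carrier R. L +> x \<in> N}"
  have K: "left_ideal K R"
    unfolding left_ideal_def
  proof (intro conjI ballI)
    show "K \<subseteq> carrier R" "\<zero> \<in> K"
      using N0 coset_eq_ideal_iff[of \<zero>] left_idealD(2)[OF left_ideal] by (auto simp: K_def)
    show "x \<oplus> y \<in> K" if "x \<in> K" "y \<in> K" for x y
      using that Na[of "L +> x" "L +> y"] by (simp add: K_def quotient_add)
    show "r \<otimes> x \<in> K" if "r \<in> carrier R" "x \<in> K" for r x
      using that N.smult_closed[of r "L +> x"] by (simp add: K_def quotient_smult)
  qed
  have LK: "L \<subseteq> K"
    using N0 L_closed by (auto simp: K_def a_rcos_const)
  have NK: "N = (\<lambda>x. L +> x) ` K"
    using Nc by (auto simp: K_def quotient_carrier)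
  show "N = {\<zero>\<^bsub>Q\<^esub>} \<or> N = carrier Q"
  proof (cases "\<one> \<in> K")
    case True
    then have "K = carrier R"
      by (rule left_ideal_one[OF K])
    then show ?thesis
      by (simp add: NK quotient_carrier)
  next
    case False
    then have "K = L"
      using assms K LK by (auto simp: maximal_left_ideal_def)
    moreover have "(\<lambda>x. L +> x) ` L = (\<lambda>x. L) ` L"
      by (rule image_cong) (simp_all add: a_rcos_const)
    ultimately have "N = {L}"
      using NK left_idealD(2)[OF left_ideal] by (simp add: image_constant)
    then show ?thesis
      by (simp add: quotient_zero)
  qed
qed

end

section \<open>Flatness of cyclic modules\<close>

text \<open>A copy of a right ideal \<open>I\<close> on singletons, since flatness is tested on modules over
  \<^typ>\<open>'a set\<close>.\<close>

definition singleton_module :: "('a, 'm) ring_scheme \<Rightarrow> 'a set \<Rightarrow> ('a, 'a set) module" where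
  "singleton_module R I =
    \<lparr>carrier = (\<lambda>x. {x}) ` I, monoid.mult = undefined, one = undefined, ring.zero = {\<zero>\<^bsub>R\<^esub>},
     add = (\<lambda>U V. {the_elem U \<oplus>\<^bsub>R\<^esub> the_elem V}), smult = (\<lambda>r U. {the_elem U \<otimes>\<^bsub>R\<^esub> r})\<rparr>"

lemma singleton_module_simps:
  "carrier (singleton_module R I) = (\<lambda>x. {x}) ` I"
  "{x} \<oplus>\<^bsub>singleton_module R I\<^esub> {y} = {x \<oplus>\<^bsub>R\<^esub> y}"
  "r \<odot>\<^bsub>singleton_module R I\<^esub> {x} = {x \<otimes>\<^bsub>R\<^esub> r}"
  "\<zero>\<^bsub>singleton_module R I\<^esub> = {\<zero>\<^bsub>R\<^esub>}"
  by (simp_all add: singleton_module_def)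

lemma (in ring) singleton_right_module:
  assumes I: "I \<subseteq> carrier R" "\<zero> \<in> I" "\<And>x y. x \<in> I \<Longrightarrow> y \<in> I \<Longrightarrow> x \<oplus> y \<in> I"
    "\<And>x r. x \<in> I \<Longrightarrow> r \<in> carrier R \<Longrightarrow> x \<otimes> r \<in> I"
  shows "right_module R (singleton_module R I)"
proof -
  have Ic [simp]: "x \<in> carrier R" if "x \<in> I" for x
    using I(1) that by blast
  note [simp] = I(2-4)
  have neg: "\<ominus> x \<in> I" if "x \<in> I" for x
    using I(4)[OF that, of "\<ominus> \<one>"] Ic[OF that] by (simp add: r_minus)
  show ?thesis
  proof (intro right_module.intro right_module_axioms.intro)
    show "abelian_group (singleton_module R I)"
    proof (rule abelian_groupI)
      fix U assume "U \<in> carrier (singleton_module R I)"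
      then obtain x where x: "x \<in> I" "U = {x}"
        by (auto simp: singleton_module_simps)
      then have "{\<ominus> x} \<oplus>\<^bsub>singleton_module R I\<^esub> U = \<zero>\<^bsub>singleton_module R I\<^esub>"
        by (simp add: singleton_module_simps l_neg)
      then show "\<exists>V \<in> carrier (singleton_module R I).
          V \<oplus>\<^bsub>singleton_module R I\<^esub> U = \<zero>\<^bsub>singleton_module R I\<^esub>"
        using neg x by (auto simp: singleton_module_simps(1))
    qed (auto simp: singleton_module_simps a_ac)
  qed (auto simp: singleton_module_simps l_distr r_distr m_assoc ring_axioms)
qed

lemma (in ring) principal_right_module:
  assumes a: "a \<in> carrier R"
  shows "right_module R (singleton_module R ((\<lambda>r. a \<otimes> r) ` carrier R))"
proof (rule singleton_right_module)
  have "a \<otimes> \<zero> = \<zero>"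
    using a by simp
  then show "\<zero> \<in> (\<lambda>r. a \<otimes> r) ` carrier R"
    by (metis imageI zero_closed)
qed (use a in \<open>auto simp: m_assoc simp flip: r_distr\<close>)

section \<open>Evaluating tensors over R/L, and the membership criterion obtained from
  flatness\<close>

context ring_left_ideal
begin

definition rep :: "'a set \<Rightarrow> 'a" where
  "rep U = (SOME x. x \<in> U)"

lemma rep:
  assumes "U \<in> carrier Q"
  shows "rep U \<in> carrier R" "L +> rep U = U"
proof -
  obtain x where x: "x \<in> carrier R" "U = L +> x"
    using assms by (auto simp: quotient_carrier)
  have "rep U \<in> U"
    unfolding rep_def using x a_rcos_self by (metis someI)
  then show "rep U \<in> carrier R" "L +> rep U = U"
    using x a_elemrcos_carrier a_repr_independence' by auto
qed

text \<open>The target of the map \<open>aR \<otimes> R/L \<rightarrow> aR/aL\<close> is replaced by \<open>R\<close> itself: sending \<open>(u, U)\<close> to \<open>u\<close>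
  times a chosen representative of \<open>U\<close> is biadditive and balanced only modulo \<open>aL\<close>.\<close>

lemma tensor_rel_representatives:
  assumes a: "a \<in> carrier R"
    and h: "h \<in> hom (free_Abelian_group (carrier A \<times> carrier Q)) (add_monoid R)"
    and A: "A = singleton_module R ((\<lambda>r. a \<otimes> r) ` carrier R)"
    and h_of: "\<And>u U. u \<in> carrier A \<Longrightarrow> U \<in> carrier Q \<Longrightarrow>
      h (frag_of (u, U)) = the_elem u \<otimes> rep U"
    and p: "p \<in> tensor_rel R A Q"
  shows "h p \<in> (\<lambda>l. a \<otimes> l) ` L"
proof -
  let ?F = "free_Abelian_group (carrier A \<times> carrier Q)"
  interpret M: left_module R Q
    by (rule quotient_left_module)
  interpret h: group_hom ?F "add_monoid R" h
    by (intro group_hom.intro group_hom_axioms.intro h group_free_Abelian_group add.is_group)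
  have aL: "subgroup ((\<lambda>l. a \<otimes> l) ` L) (add_monoid R)"
  proof (rule add.subgroupI)
    show "(\<lambda>l. a \<otimes> l) ` L \<noteq> {}"
      using left_idealD(2)[OF left_ideal] by blast
  qed (use a L_closed left_idealD(3)[OF left_ideal] left_ideal_uminus[OF left_ideal] in
      \<open>auto simp: r_minus[symmetric] r_distr[symmetric] simp flip: a_inv_def\<close>)
  interpret aL: subgroup "(\<lambda>l. a \<otimes> l) ` L" "add_monoid R"
    by (rule aL)
  have RA: "right_module R A"
    unfolding A by (rule principal_right_module[OF a])
  interpret A: right_module R A
    by (rule RA)
  interpret T: subgroup "tensor_rel R A Q" ?F
    by (rule tensor_rel_subgroup[OF RA quotient_left_module])
  have hdiff: "h (x - y) = h x \<ominus> h y" if "x \<in> carrier ?F" "y \<in> carrier ?F" for x y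
  proof -
    have "x - y = x \<otimes>\<^bsub>?F\<^esub> inv\<^bsub>?F\<^esub> y"
      using that by simp
    then show ?thesis
      using that h.hom_mult[of x "inv\<^bsub>?F\<^esub> y"] h.hom_inv[of y]
      by (simp add: a_minus_def a_inv_def del: mult_free_Abelian_group inv_free_Abelian_group
          carrier_free_Abelian_group_iff)
  qed
  \<comment> \<open>An element of \<open>A\<close> has the form \<open>{a \<otimes> r}\<close>, and
    \<open>r\<close> is absorbed by the left ideal \<open>L\<close>.\<close>
  have aLI: "u \<otimes> l \<in> (\<lambda>l. a \<otimes> l) ` L" if "{u} \<in> carrier A" "l \<in> L" for u l
    using that a L_closed left_idealD(4)[OF left_ideal]
    by (auto simp: A singleton_module_simps m_assoc)
  have h2: "h (frag_of z - frag_of z') = h (frag_of z) \<ominus> h (frag_of z')"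
    if "z \<in> carrier A \<times> carrier Q" "z' \<in> carrier A \<times> carrier Q" for z z'
    using that by (simp add: hdiff)
  have h3: "h (frag_of z - frag_of z' - frag_of z'') =
      h (frag_of z) \<ominus> h (frag_of z') \<ominus> h (frag_of z'')"
    if "z \<in> carrier A \<times> carrier Q" "z' \<in> carrier A \<times> carrier Q" "z'' \<in> carrier A \<times> carrier Q"
    for z z' z''
    using that keys_diff[of "frag_of z" "frag_of z'"]
    by (subst hdiff) (auto simp: h2)
  let ?gens = "{frag_of (u \<oplus>\<^bsub>A\<^esub> u', U) - frag_of (u, U) - frag_of (u', U) | u u' U.
         u \<in> carrier A \<and> u' \<in> carrier A \<and> U \<in> carrier Q} \<union>
      {frag_of (u, U \<oplus>\<^bsub>Q\<^esub> V) - frag_of (u, U) - frag_of (u, V) | u U V.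
         u \<in> carrier A \<and> U \<in> carrier Q \<and> V \<in> carrier Q} \<union>
      {frag_of (r \<odot>\<^bsub>A\<^esub> u, U) - frag_of (u, r \<odot>\<^bsub>Q\<^esub> U) | u r U.
         u \<in> carrier A \<and> r \<in> carrier R \<and> U \<in> carrier Q}"
  have rel_gens: "tensor_rel R A Q = generate ?F ?gens"
    by (simp only: tensor_rel_def)
  have A_singleton: "\<exists>x \<in> carrier R. u = {x}" if "u \<in> carrier A" for u
    using that a by (auto simp: A singleton_module_simps)
  have gen: "h g \<in> (\<lambda>l. a \<otimes> l) ` L" if "g \<in> ?gens" for g
    using that
  proof (elim UnE CollectE exE conjE)
    fix u u' U assume g: "g = frag_of (u \<oplus>\<^bsub>A\<^esub> u', U) - frag_of (u, U) - frag_of (u', U)"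
      and u: "u \<in> carrier A" "u' \<in> carrier A" and U: "U \<in> carrier Q"
    obtain x y where xy: "x \<in> carrier R" "u = {x}" "y \<in> carrier R" "u' = {y}"
      using u A_singleton by blast
    have "u \<oplus>\<^bsub>A\<^esub> u' = {x \<oplus> y}"
      using xy by (simp add: A singleton_module_simps)
    then have "h g = (x \<oplus> y) \<otimes> rep U \<ominus> x \<otimes> rep U \<ominus> y \<otimes> rep U"
      using A.M.a_closed[OF u] u U xy by (simp add: g h3 h_of)
    \<comment> \<open>Additivity in the first argument is exact, because all three terms use the
      same representative of \<open>U\<close>.\<close>
    also have "\<dots> = \<zero>"
      using xy rep(1)[OF U] by algebra
    finally show ?thesis
      using aL.one_closed by simp
  next
    fix u U V assume g: "g = frag_of (u, U \<oplus>\<^bsub>Q\<^esub> V) - frag_of (u, U) - frag_of (u, V)"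
      and u: "u \<in> carrier A" and U: "U \<in> carrier Q" and V: "V \<in> carrier Q"
    obtain x where x: "x \<in> carrier R" "u = {x}"
      using u A_singleton by blast
    let ?W = "U \<oplus>\<^bsub>Q\<^esub> V"
    have W: "?W \<in> carrier Q"
      using U V by simp
    have "?W = L +> (rep U \<oplus> rep V)"
      using quotient_add[OF rep(1)[OF U] rep(1)[OF V]] rep(2)[OF U] rep(2)[OF V] by simp
    \<comment> \<open>The chosen representative of a sum need not be the sum of the chosen
      representatives; the error lies in \<open>L\<close>, so it contributes an element of
      \<open>aL\<close>.\<close>
    then have *: "rep ?W \<ominus> (rep U \<oplus> rep V) \<in> L"
      using rep[OF W] rep(1)[OF U] rep(1)[OF V] coset_eq_iff by simp
    have "h g = x \<otimes> rep ?W \<ominus> x \<otimes> rep U \<ominus> x \<otimes> rep V"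
      using u U V W x by (simp add: g h3 h_of)
    also have "\<dots> = x \<otimes> (rep ?W \<ominus> (rep U \<oplus> rep V))"
      using x rep(1)[OF U] rep(1)[OF V] rep(1)[OF W]
      by (simp add: a_minus_def r_distr r_minus minus_add a_assoc)
    finally show ?thesis
      using aLI[OF _ *] u x by simp
  next
    fix u r U assume g: "g = frag_of (r \<odot>\<^bsub>A\<^esub> u, U) - frag_of (u, r \<odot>\<^bsub>Q\<^esub> U)"
      and u: "u \<in> carrier A" and r: "r \<in> carrier R" and U: "U \<in> carrier Q"
    obtain x where x: "x \<in> carrier R" "u = {x}"
      using u A_singleton by blast
    let ?W = "r \<odot>\<^bsub>Q\<^esub> U"
    have W: "?W \<in> carrier Q"
      using r U by (rule M.smult_closed)
    have "L +> (r \<otimes> rep U) = ?W"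
      using quotient_smult[OF r rep(1)[OF U]] rep(2)[OF U] by simp
    then have *: "r \<otimes> rep U \<ominus> rep ?W \<in> L"
      using coset_eq_iff[OF m_closed[OF r rep(1)[OF U]] rep(1)[OF W]] rep(2)[OF W] by metis
    have "r \<odot>\<^bsub>A\<^esub> u = {x \<otimes> r}"
      using x by (simp add: A singleton_module_simps)
    then have "h g = (x \<otimes> r) \<otimes> rep U \<ominus> x \<otimes> rep ?W"
      using A.smult_closed[OF r u] u U W x by (simp add: g h2 h_of)
    also have "\<dots> = x \<otimes> (r \<otimes> rep U \<ominus> rep ?W)"
      using x r rep(1)[OF U] rep(1)[OF W] by (simp add: a_minus_def r_distr r_minus m_assoc)
    finally show ?thesis
      using aLI[OF _ *] u x by simp
  qed
  from p show ?thesis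
    unfolding rel_gens
  proof (induction rule: generate.induct)
    case one
    then show ?case
      using h.hom_one aL.one_closed by simp
  next
    case (incl g)
    then show ?case
      by (rule gen)
  next
    case (inv g)
    have "g \<in> carrier ?F"
      using T.mem_carrier generate.incl[OF inv] unfolding rel_gens by blast
    then show ?case
      using h.hom_inv aL.m_inv_closed[OF gen[OF inv]] by metis
  next
    case (eng g g')
    then have "g \<in> carrier ?F" "g' \<in> carrier ?F"
      using T.mem_carrier unfolding rel_gens by blast+
    then show ?case
      using h.hom_mult aL.m_closed[OF eng.IH] by metis
  qed
qed

text \<open>In the tensor product of \<open>R\<close> and \<open>R/L\<close>, the scalar
  \<open>a\<close> moves across to give \<open>\<one>\<close> tensor the class of \<open>a\<close>,
  which is zero because \<open>a\<close> lies in \<open>L\<close>. Injectivity transfers the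
  vanishing to \<open>aR\<close>, where evaluation by representatives detects it modulo
  \<open>aL\<close>.\<close>

lemma flat_quotient_mem:
  assumes flat: "flat_left_module TYPE('a set) R Q" and aL: "a \<in> L"
  shows "\<exists>b \<in> L. a = a \<otimes> b"
proof -
  have a: "a \<in> carrier R"
    using aL L_closed by blast
  define A where "A = singleton_module R ((\<lambda>r. a \<otimes> r) ` carrier R)"
  define B where "B = singleton_module R (carrier R)"
  let ?FA = "free_Abelian_group (carrier A \<times> carrier Q)"
  let ?FB = "free_Abelian_group (carrier B \<times> carrier Q)"
  have A: "right_module R A"
    unfolding A_def by (rule principal_right_module[OF a])
  have B: "right_module R B"
    unfolding B_def by (rule singleton_right_module) auto
  note M = quotient_left_module
  \<comment> \<open>On singletons, the inclusion of \<open>aR\<close> into \<open>R\<close> is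
    literally the identity function.\<close>
  have id: "(\<lambda>u. u) \<in> module_hom R A B"
    using a by (auto simp: module_hom_def hom_def A_def B_def singleton_module_simps)
  have inj: "inj_on (tensor_map R B Q (\<lambda>u. u)) (carrier (tensor_product R A Q))"
    using flat A B id by (auto simp: flat_left_module_def)
  have push: "tensor_push (\<lambda>u. u) p = p" for p :: "'a set \<times> 'a set \<Rightarrow>\<^sub>0 int"
  proof -
    have "(\<lambda>(u, U). frag_of (u, U)) = (frag_of :: 'a set \<times> 'a set \<Rightarrow> _)"
      by auto
    then show ?thesis
      by (simp add: tensor_push_def frag_expansion[symmetric])
  qed
  interpret SA: subgroup "tensor_rel R A Q" ?FA
    by (rule tensor_rel_subgroup[OF A M])
  interpret SB: subgroup "tensor_rel R B Q" ?FB
    by (rule tensor_rel_subgroup[OF B M])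
  interpret FA: group ?FA by simp
  interpret FB: group ?FB by simp
  define p where "p = frag_of ({a}, L +> \<one>)"
  have "a \<otimes> \<one> \<in> (\<lambda>r. a \<otimes> r) ` carrier R"
    by blast
  then have aA: "{a} \<in> carrier A"
    using a by (simp add: A_def singleton_module_simps)
  have oneQ: "L +> \<one> \<in> carrier Q"
    by (auto simp: quotient_carrier)
  have LQ: "L \<in> carrier Q"
    using coset_eq_ideal_iff[of \<zero>] left_idealD(2)[OF left_ideal]
    by (auto simp: quotient_carrier intro: image_eqI[of _ _ \<zero>])
  have oneB: "{\<one>} \<in> carrier B"
    by (auto simp: B_def singleton_module_simps)
  have pA: "p \<in> carrier ?FA"
    using aA oneQ by (simp add: p_def)
  have pB: "p \<in> tensor_rel R B Q"
  proof -
    \<comment> \<open>Balancedness turns the generator at \<open>({a}, L +> \<one>)\<close> into the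
      one at \<open>({\<one>}, L)\<close>, whose second entry is the zero of
      \<open>Q\<close>.\<close>
    have "frag_of (a \<odot>\<^bsub>B\<^esub> {\<one>}, L +> \<one>) - frag_of ({\<one>}, a \<odot>\<^bsub>Q\<^esub> (L +> \<one>)) \<in> tensor_rel R B Q"
      unfolding tensor_rel_def by (rule generate.incl) (use a oneB oneQ in blast)
    moreover have "a \<odot>\<^bsub>Q\<^esub> (L +> \<one>) = L"
      using a aL by (simp add: quotient_smult coset_eq_ideal_iff)
    moreover have "a \<odot>\<^bsub>B\<^esub> {\<one>} = {a}"
      using a by (simp add: B_def singleton_module_simps)
    ultimately have 1: "p - frag_of ({\<one>}, L) \<in> tensor_rel R B Q"
      by (simp add: p_def)
    \<comment> \<open>Additivity at zero plus zero: two of the three terms cancel, leaving minus the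
      generator with zero second entry.\<close>
    have "frag_of ({\<one>}, L \<oplus>\<^bsub>Q\<^esub> L) - frag_of ({\<one>}, L) - frag_of ({\<one>}, L) \<in> tensor_rel R B Q"
      unfolding tensor_rel_def by (rule generate.incl) (use LQ oneB in blast)
    moreover have "L \<oplus>\<^bsub>Q\<^esub> L = L"
      using quotient_add[of \<zero> \<zero>] coset_eq_ideal_iff[of \<zero>] left_idealD(2)[OF left_ideal] by simp
    ultimately have 2: "- frag_of ({\<one>}, L) \<in> tensor_rel R B Q"
      by simp
    have "inv\<^bsub>?FB\<^esub> (- frag_of ({\<one>}, L)) = frag_of ({\<one>}, L)"
      using LQ oneB by simp
    then have "frag_of ({\<one>}, L) \<in> tensor_rel R B Q"
      using SB.m_inv_closed[OF 2] by simp
    then show ?thesis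
      using SB.m_closed[OF 1, of "frag_of ({\<one>}, L)"] by simp
  qed
  have coset: "tensor_map R B Q (\<lambda>u. u) (tensor_rel R A Q #>\<^bsub>?FA\<^esub> q) = tensor_rel R B Q #>\<^bsub>?FB\<^esub> q"
    if "q \<in> carrier ?FA" for q
    using tensor_map_coset[OF A B M id that] by (simp add: push)
  have "tensor_rel R B Q #>\<^bsub>?FB\<^esub> p = tensor_rel R B Q #>\<^bsub>?FB\<^esub> \<one>\<^bsub>?FA\<^esub>"
    using FB.coset_join2[OF _ SB.is_subgroup pB] FB.coset_join2[OF _ SB.is_subgroup SB.one_closed] SB.mem_carrier[OF pB] by simp
  then have "tensor_map R B Q (\<lambda>u. u) (tensor_rel R A Q #>\<^bsub>?FA\<^esub> p) =
      tensor_map R B Q (\<lambda>u. u) (tensor_rel R A Q #>\<^bsub>?FA\<^esub> \<one>\<^bsub>?FA\<^esub>)"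
    by (simp only: coset[OF pA] coset[OF FA.one_closed])
  moreover have "tensor_rel R A Q #>\<^bsub>?FA\<^esub> q \<in> carrier (tensor_product R A Q)"
    if "q \<in> carrier ?FA" for q
    using that unfolding tensor_product_def FactGroup_def RCOSETS_def by auto
  ultimately have "tensor_rel R A Q #>\<^bsub>?FA\<^esub> p = tensor_rel R A Q #>\<^bsub>?FA\<^esub> \<one>\<^bsub>?FA\<^esub>"
    using inj pA FA.one_closed by (meson inj_onD)
  also have "\<dots> = tensor_rel R A Q"
    by (rule FA.coset_join2[OF FA.one_closed SA.is_subgroup SA.one_closed])
  finally have p: "p \<in> tensor_rel R A Q"
    by (metis FA.rcos_self[OF pA SA.is_subgroup])
  have "(\<lambda>(u, U). the_elem u \<otimes> rep U) ` (carrier A \<times> carrier Q) \<subseteq> carrier (add_monoid R)"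
    using a rep(1) by (auto simp: A_def singleton_module_simps)
  then obtain h where h: "h \<in> hom ?FA (add_monoid R)"
    and h_of: "\<And>z. z \<in> carrier A \<times> carrier Q \<Longrightarrow>
      h (frag_of z) = (\<lambda>(u, U). the_elem u \<otimes> rep U) z"
    by (rule comm_group.free_Abelian_group_universal[OF a_comm_group]) (rule that)
  have "h p \<in> (\<lambda>l. a \<otimes> l) ` L"
    by (rule tensor_rel_representatives[OF a h A_def _ p]) (simp add: h_of)
  then obtain l where l: "l \<in> L" "a \<otimes> rep (L +> \<one>) = a \<otimes> l"
    using aA oneQ by (auto simp: p_def h_of)
  have r: "rep (L +> \<one>) \<in> carrier R" "rep (L +> \<one>) \<ominus> \<one> \<in> L"
    using rep[OF oneQ] coset_eq_iff[of "rep (L +> \<one>)" \<one>] by (simp_all only: one_closed)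
  \<comment> \<open>The representative of \<open>L +> \<one>\<close> need not be
    \<open>\<one>\<close>, only congruent to it modulo \<open>L\<close>. Subtracting that difference
    from \<open>l\<close> corrects the error and keeps the witness in \<open>L\<close>.\<close>
  let ?b = "l \<ominus> (rep (L +> \<one>) \<ominus> \<one>)"
  have "a \<otimes> ?b = a \<otimes> l \<ominus> a \<otimes> rep (L +> \<one>) \<oplus> a"
    using a r l L_closed by (simp add: a_minus_def r_distr r_minus minus_add a_assoc)
  then have "a = a \<otimes> ?b"
    using a r l L_closed by (simp add: a_minus_def r_neg)
  then show ?thesis
    using left_ideal_minus[OF left_ideal l(1) r(2)] by blast
qed

end

section \<open>Hypercenter\<close>

context ring
begin

lemma hypercenterD:
  assumes "a \<in> hypercenter R"
  shows "a \<in> carrier R"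
    "\<And>x. x \<in> carrier R \<Longrightarrow> \<exists>n::nat. n \<ge> 1 \<and> a \<otimes> x [^] n = x [^] n \<otimes> a"
  using assms by (auto simp: hypercenter_def)

lemma commute_nat_pow:
  assumes "a \<in> carrier R" "y \<in> carrier R" "a \<otimes> y = y \<otimes> a"
  shows "a \<otimes> y [^] (k::nat) = y [^] k \<otimes> a"
proof (induction k)
  case (Suc k)
  then show ?case
    using assms by (simp add: m_assoc[symmetric]) (simp add: m_assoc)
qed (use assms in simp)

text \<open>The exponents for \<open>a\<close> and \<open>b\<close> may differ, but their product
  works for both, since commuting with an element implies commuting with its powers.\<close>

lemma hypercenter_add:
  assumes "a \<in> hypercenter R" "b \<in> hypercenter R"
  shows "a \<oplus> b \<in> hypercenter R"
  unfolding hypercenter_def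
proof (intro CollectI conjI ballI)
  have ab: "a \<in> carrier R" "b \<in> carrier R"
    using assms hypercenterD(1) by auto
  then show "a \<oplus> b \<in> carrier R"
    by simp
  fix x assume x: "x \<in> carrier R"
  obtain n m :: nat where n: "n \<ge> 1" "a \<otimes> x [^] n = x [^] n \<otimes> a"
    and m: "m \<ge> 1" "b \<otimes> x [^] m = x [^] m \<otimes> b"
    using hypercenterD(2)[OF assms(1) x] hypercenterD(2)[OF assms(2) x] by blast
  have "a \<otimes> x [^] (n * m) = x [^] (n * m) \<otimes> a"
    using commute_nat_pow[OF ab(1) _ n(2), of m] x by (simp add: nat_pow_pow)
  moreover have "b \<otimes> x [^] (n * m) = x [^] (n * m) \<otimes> b"
    using commute_nat_pow[OF ab(2) _ m(2), of n] x by (simp add: nat_pow_pow mult.commute)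
  ultimately have "(a \<oplus> b) \<otimes> x [^] (n * m) = x [^] (n * m) \<otimes> (a \<oplus> b)"
    using ab x by (simp add: l_distr r_distr)
  then show "\<exists>k::nat. k \<ge> 1 \<and> (a \<oplus> b) \<otimes> x [^] k = x [^] k \<otimes> (a \<oplus> b)"
    using n(1) m(1) by (intro exI[of _ "n * m"]) simp
qed

lemma hypercenter_zero: "\<zero> \<in> hypercenter R"
  by (auto simp: hypercenter_def)

lemma H_semicommutativeD:
  assumes "H_semicommutative R" "u \<in> carrier R" "v \<in> carrier R" "u \<otimes> v = \<zero>" "r \<in> carrier R"
  shows "u \<otimes> r \<otimes> v \<in> hypercenter R"
  using assms unfolding H_semicommutative_def by blast

end

section \<open>Strong regularity\<close>

locale H_semicommutative_SF_ring = ring R for R (structure) +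
  assumes H_semicommutative: "H_semicommutative R"
    and SF: "left_SF_ring R"
begin

text \<open>The only place where the SF hypothesis enters: the quotient by a maximal left ideal is
  simple, hence flat.\<close>

lemma maximal_left_ideal_mem:
  assumes L: "maximal_left_ideal L R" and a: "a \<in> L"
  shows "\<exists>b \<in> L. a = a \<otimes> b"
proof -
  interpret ring_left_ideal R L
    using L by unfold_locales (simp add: maximal_left_ideal_def)
  have "flat_left_module TYPE('a set) R Q"
    using SF quotient_simple[OF L] by (simp add: left_SF_ring_def)
  then show ?thesis
    using a by (rule flat_quotient_mem)
qed

text \<open>Hypercentrality of \<open>t\<close> is used twice: against powers of \<open>b\<close>,
  to show that \<open>Rt\<close> and the left annihilator of \<open>t\<close> together span
  \<open>R\<close>, and against powers of \<open>s\<close>, to turn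
  \<open>t = s \<otimes> (t \<otimes> t)\<close> into regularity.\<close>

lemma hypercenter_regular:
  assumes t: "t \<in> hypercenter R"
  shows "\<exists>s \<in> carrier R. t = t \<otimes> s \<otimes> t"
proof -
  have tc: "t \<in> carrier R"
    by (rule hypercenterD(1)[OF t])
  define N where "N = {y \<in> carrier R. y \<otimes> t = \<zero>}"
  define K where "K = {s \<otimes> t \<oplus> y | s y. s \<in> carrier R \<and> y \<in> N}"
  have N: "left_ideal N R"
    using tc by (auto simp: N_def left_ideal_def l_distr m_assoc)
  have K: "left_ideal K R"
    unfolding K_def by (rule left_ideal_principal_add[OF N tc])
  have "\<one> \<in> K"
  proof (rule ccontr)
    assume "\<one> \<notin> K"
    then obtain L where L: "maximal_left_ideal L R" and KL: "K \<subseteq> L"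
      using ex_maximal_left_ideal K by blast
    then have L': "left_ideal L R" and one: "\<one> \<notin> L"
      by (auto simp: maximal_left_ideal_def)
    have "t = \<one> \<otimes> t \<oplus> \<zero>"
      using tc by simp
    then have "t \<in> K"
      unfolding K_def using left_idealD(2)[OF N] by blast
    then obtain b where b: "b \<in> L" "t = t \<otimes> b"
      using maximal_left_ideal_mem[OF L] KL by blast
    have bc: "b \<in> carrier R"
      using b left_idealD(1)[OF L'] by blast
    have tb: "t \<otimes> b [^] k = t" for k :: nat
    proof (induction k)
      case (Suc k)
      have "t \<otimes> b [^] Suc k = (t \<otimes> b [^] k) \<otimes> b"
        using tc bc by (simp add: m_assoc)
      then show ?case
        using Suc b by simp
    qed (use tc in simp)
    obtain n :: nat where n: "n \<ge> 1" "t \<otimes> b [^] n = b [^] n \<otimes> t"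
      using hypercenterD(2)[OF t bc] by blast
    have bn: "b [^] n \<in> L"
      by (rule left_ideal_nat_pow[OF L' b(1) n(1)])
    \<comment> \<open>Right multiplication by \<open>b\<close> fixes \<open>t\<close>, hence so does
      right multiplication by its powers; commuting with \<open>b [^] n\<close> moves this to the
      left side.\<close>
    have "(\<one> \<ominus> b [^] n) \<otimes> t = \<zero>"
      using tc bc n tb[of n] by (simp add: a_minus_def l_distr l_minus r_neg)
    then have y: "\<one> \<ominus> b [^] n \<in> N"
      using bc by (simp add: N_def)
    have "\<one> \<ominus> b [^] n = \<zero> \<otimes> t \<oplus> (\<one> \<ominus> b [^] n)"
      using tc bc by simp
    then have "\<one> \<ominus> b [^] n \<in> K"
      unfolding K_def using y by blast
    then have "(\<one> \<ominus> b [^] n) \<oplus> b [^] n \<in> L"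
      using KL bn left_idealD(3)[OF L'] by blast
    moreover have "(\<one> \<ominus> b [^] n) \<oplus> b [^] n = \<one>"
      using bc by (simp add: a_minus_def a_assoc l_neg)
    ultimately show False
      using one by simp
  qed
  then obtain s y where s: "s \<in> carrier R" "y \<in> N" "\<one> = s \<otimes> t \<oplus> y"
    by (auto simp: K_def)
  have y: "y \<in> carrier R" "y \<otimes> t = \<zero>"
    using s by (auto simp: N_def)
  have "t = (s \<otimes> t \<oplus> y) \<otimes> t"
    using tc s(3) by (metis l_one)
  then have st: "t = s \<otimes> (t \<otimes> t)"
    using tc s(1) y by (simp add: l_distr m_assoc)
  \<comment> \<open>Repeated substitution of \<open>t = s \<otimes> (t \<otimes> t)\<close>, so that
    a power of \<open>s\<close> commuting with \<open>t\<close> can appear.\<close>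
  have pow: "t = s [^] k \<otimes> t [^] Suc k" for k :: nat
  proof (induction k)
    case (Suc k)
    have "s [^] Suc k \<otimes> t [^] Suc (Suc k) = s [^] k \<otimes> (s \<otimes> (t \<otimes> t)) \<otimes> t [^] k"
      using s(1) tc nat_pow_Suc2[OF tc, of k] nat_pow_Suc2[OF tc, of "Suc k"] by (simp add: m_assoc)
    also have "\<dots> = s [^] k \<otimes> t [^] Suc k"
      using s(1) tc nat_pow_Suc2[OF tc, of k] by (simp add: st[symmetric] m_assoc)
    finally show ?case
      using Suc by simp
  qed (use tc in simp)
  obtain n :: nat where n: "n \<ge> 1" "t \<otimes> s [^] n = s [^] n \<otimes> t"
    using hypercenterD(2)[OF t s(1)] by blast
  \<comment> \<open>Since \<open>n\<close> is positive, a last factor \<open>t\<close> can be split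
    off \<open>t [^] n\<close>; it becomes the right-hand \<open>t\<close> in the regularity
    equation.\<close>
  then obtain m where m: "n = Suc m"
    by (cases n) auto
  have "t = s [^] n \<otimes> t \<otimes> t [^] n"
    using pow[of n] nat_pow_Suc2[OF tc, of n] s(1) tc by (simp add: m_assoc)
  also have "\<dots> = t \<otimes> s [^] n \<otimes> (t [^] m \<otimes> t)"
    using n m by simp
  also have "\<dots> = t \<otimes> (s [^] n \<otimes> t [^] m) \<otimes> t"
    using s(1) tc by (simp add: m_assoc)
  finally show ?thesis
    using s(1) tc by blast
qed

text \<open>An element \<open>a\<close> is von Neumann regular as soon as \<open>a - asa\<close> is,
  for some \<open>s\<close>. It therefore suffices to choose \<open>s\<close> with this difference
  in the hypercenter.\<close>

lemma regular:
  assumes a: "a \<in> carrier R"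
  shows "\<exists>s \<in> carrier R. a = a \<otimes> s \<otimes> a"
proof -
  \<comment> \<open>Quantifying over the middle factor \<open>r\<close> makes \<open>N\<close>
    closed under left multiplication, as \<open>r \<otimes> q\<close> is again an admissible middle
    factor.\<close>
  define N where "N = {y \<in> carrier R. \<forall>r \<in> carrier R. a \<otimes> r \<otimes> y \<in> hypercenter R}"
  define K where "K = {s \<otimes> a \<oplus> y | s y. s \<in> carrier R \<and> y \<in> N}"
  have N: "left_ideal N R"
    unfolding left_ideal_def
  proof (intro conjI ballI)
    show "N \<subseteq> carrier R" "\<zero> \<in> N"
      using a hypercenter_zero by (auto simp: N_def)
    show "x \<oplus> y \<in> N" if "x \<in> N" "y \<in> N" for x y
      using that a by (auto simp: N_def r_distr hypercenter_add)
    show "q \<otimes> x \<in> N" if q: "q \<in> carrier R" and x: "x \<in> N" for q x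
    proof -
      have "a \<otimes> r \<otimes> (q \<otimes> x) = a \<otimes> (r \<otimes> q) \<otimes> x" if "r \<in> carrier R" for r
        using a q x that by (simp add: N_def m_assoc)
      then show ?thesis
        using q x by (simp add: N_def)
    qed
  qed
  have K: "left_ideal K R"
    unfolding K_def by (rule left_ideal_principal_add[OF N a])
  have "\<one> \<in> K"
  proof (rule ccontr)
    assume "\<one> \<notin> K"
    then obtain L where L: "maximal_left_ideal L R" and KL: "K \<subseteq> L"
      using ex_maximal_left_ideal K by blast
    then have L': "left_ideal L R" and one: "\<one> \<notin> L"
      by (auto simp: maximal_left_ideal_def)
    have "a = \<one> \<otimes> a \<oplus> \<zero>"
      using a by simp
    then have "a \<in> K"
      unfolding K_def using left_idealD(2)[OF N] by blast
    then obtain b where b: "b \<in> L" "a = a \<otimes> b"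
      using maximal_left_ideal_mem[OF L] KL by blast
    have bc: "b \<in> carrier R"
      using b left_idealD(1)[OF L'] by blast
    have "a \<otimes> (\<one> \<ominus> b) = \<zero>"
      using a bc b(2)[symmetric] by (simp add: a_minus_def r_distr r_minus r_neg)
    \<comment> \<open>H-semicommutativity extends the single relation
      \<open>a \<otimes> (\<one> \<ominus> b) = \<zero>\<close> to every middle factor.\<close>
    then have y: "\<one> \<ominus> b \<in> N"
      using a bc H_semicommutativeD[OF H_semicommutative, of a "\<one> \<ominus> b"] by (simp add: N_def)
    have "\<one> \<ominus> b = \<zero> \<otimes> a \<oplus> (\<one> \<ominus> b)"
      using a bc by simp
    then have "\<one> \<ominus> b \<in> K"
      unfolding K_def using y by blast
    then have "(\<one> \<ominus> b) \<oplus> b \<in> L"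
      using KL b(1) left_idealD(3)[OF L'] by blast
    moreover have "(\<one> \<ominus> b) \<oplus> b = \<one>"
      using bc by (simp add: a_minus_def a_assoc l_neg)
    ultimately show False
      using one by simp
  qed
  then obtain s y where s: "s \<in> carrier R" "y \<in> N" "\<one> = s \<otimes> a \<oplus> y"
    by (auto simp: K_def)
  \<comment> \<open>Taking \<open>r = \<one>\<close> in the definition of \<open>N\<close>; here
    \<open>a \<otimes> y\<close> is \<open>a - asa\<close>.\<close>
  have y: "y \<in> carrier R" "a \<otimes> \<one> \<otimes> y \<in> hypercenter R"
    using s(2) one_closed unfolding N_def by blast+
  obtain z where z: "z \<in> carrier R" "a \<otimes> y = a \<otimes> y \<otimes> z \<otimes> (a \<otimes> y)"
    using hypercenter_regular[OF y(2)] a by auto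
  have y_eq: "y = \<one> \<ominus> s \<otimes> a"
    using s(1,3) y a by (metis a_minus_def add.m_comm add.inv_solve_right m_closed one_closed)
  have "a = a \<otimes> (s \<otimes> a \<oplus> y)"
    using a s(3) by (metis r_one)
  also have "\<dots> = a \<otimes> s \<otimes> a \<oplus> a \<otimes> y \<otimes> z \<otimes> (a \<otimes> y)"
    using a s(1) y(1) z(2) by (simp add: r_distr m_assoc)
  \<comment> \<open>Both \<open>a(1 - sa)\<close> and \<open>(1 - as)a\<close> equal
    \<open>a - asa\<close>. Using the first form left of \<open>z\<close> and the second right of it
    brings \<open>a\<close> to both ends.\<close>
  also have "a \<otimes> y = (\<one> \<ominus> a \<otimes> s) \<otimes> a"
    using a s(1) by (simp add: y_eq a_minus_def l_distr r_distr l_minus r_minus m_assoc)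
  also have "a \<otimes> s \<otimes> a \<oplus> (\<one> \<ominus> a \<otimes> s) \<otimes> a \<otimes> z \<otimes> ((\<one> \<ominus> a \<otimes> s) \<otimes> a) =
      a \<otimes> (s \<oplus> (\<one> \<ominus> s \<otimes> a) \<otimes> z \<otimes> (\<one> \<ominus> a \<otimes> s)) \<otimes> a"
    using a s(1) z(1)
    by (simp add: a_minus_def l_distr r_distr l_minus r_minus m_assoc)
  finally show ?thesis
    using a s(1) z(1) by blast
qed

text \<open>As \<open>e\<close> and \<open>1 - e\<close> annihilate each other,
  \<open>ex(1 - e)\<close> and \<open>(1 - e)xe\<close> are hypercentral and so commute with
  \<open>e\<close>. Multiplying by \<open>e\<close> on one side fixes each of them and on the other
  side kills it, so both vanish.\<close>

lemma idempotent_central: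
  assumes e: "e \<in> carrier R" "e \<otimes> e = e" and x: "x \<in> carrier R"
  shows "e \<otimes> x = e \<otimes> x \<otimes> e" "x \<otimes> e = e \<otimes> x \<otimes> e"
proof -
  \<comment> \<open>The exponent must be positive, since \<open>e [^] 0\<close> is
    \<open>\<one>\<close>; the hypercenter provides such an exponent.\<close>
  have pow: "e [^] n = e" if "n \<ge> 1" for n :: nat
    using that by (induction n rule: dec_induct) (simp_all add: e)
  have commute: "t \<otimes> e = e \<otimes> t" if "t \<in> hypercenter R" for t
    using hypercenterD(2)[OF that e(1)] pow by auto
  let ?f = "\<one> \<ominus> e"
  have f: "?f \<in> carrier R" "e \<otimes> ?f = \<zero>" "?f \<otimes> e = \<zero>"
    using e by (simp_all add: a_minus_def l_distr r_distr l_minus r_minus r_neg)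
  have "e \<otimes> x \<otimes> ?f \<in> hypercenter R"
    by (rule H_semicommutativeD[OF H_semicommutative e(1) f(1,2) x])
  then have "e \<otimes> (e \<otimes> x \<otimes> ?f) = e \<otimes> x \<otimes> ?f \<otimes> e"
    by (simp add: commute)
  also have "\<dots> = \<zero>"
    using e f x by (simp add: m_assoc)
  also have "e \<otimes> (e \<otimes> x \<otimes> ?f) = e \<otimes> x \<otimes> ?f"
    using e f x by (simp add: m_assoc[symmetric])
  finally have "e \<otimes> x \<ominus> e \<otimes> x \<otimes> e = \<zero>"
    using e x by (simp add: a_minus_def r_distr r_minus)
  then show "e \<otimes> x = e \<otimes> x \<otimes> e"
    using e x by simp
  have "?f \<otimes> x \<otimes> e \<in> hypercenter R"
    by (rule H_semicommutativeD[OF H_semicommutative f(1) e(1) f(3) x])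
  then have "?f \<otimes> x \<otimes> e \<otimes> e = e \<otimes> (?f \<otimes> x \<otimes> e)"
    by (rule commute)
  also have "\<dots> = \<zero>"
    using e f x by (simp add: m_assoc[symmetric])
  also have "?f \<otimes> x \<otimes> e \<otimes> e = ?f \<otimes> x \<otimes> e"
    using e f x by (simp add: m_assoc)
  finally have "x \<otimes> e \<ominus> e \<otimes> x \<otimes> e = \<zero>"
    using e x by (simp add: a_minus_def l_distr l_minus)
  then show "x \<otimes> e = e \<otimes> x \<otimes> e"
    using e x by simp
qed

text \<open>From \<open>a = asa\<close>, the element \<open>as\<close> is idempotent, hence central,
  and may be moved past \<open>a\<close> to give \<open>a = aas\<close>.\<close>

lemma strongly_regular: "strongly_regular R"
  unfolding strongly_regular_def
proof
  fix a assume a: "a \<in> carrier R"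
  then obtain s where s: "s \<in> carrier R" "a = a \<otimes> s \<otimes> a"
    using regular by blast
  let ?e = "a \<otimes> s"
  have "?e \<otimes> ?e = ?e"
    using a s by (metis m_assoc m_closed)
  then have "?e \<otimes> a = a \<otimes> ?e"
    using idempotent_central[of ?e a] a s(1) by auto
  then have "a = a [^] (2::nat) \<otimes> s"
    using a s by (simp add: numeral_2_eq_2 m_assoc)
  then show "\<exists>b \<in> carrier R. a = a [^] (2::nat) \<otimes> b"
    using s(1) by blast
qed

end

theorem proposition2p15:
  fixes R :: "('a, 'm) ring_scheme"
  assumes "ring R"
    and "H_semicommutative R"
    and "left_SF_ring R"
  shows "strongly_regular R"
proof -
  interpret H_semicommutative_SF_ring R
    using assms by (simp add: H_semicommutative_SF_ring_def H_semicommutative_SF_ring_axioms_def)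
  show ?thesis
    by (rule strongly_regular)
qed

end
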